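(* Let $(A,\mu)$ be a nonassociative algebra over $\mathbb{K}$ and let $\alpha$ be an automorphism of $(A,\mu)$. Put $\mu_\alpha := \alpha\circ\mu$. Then $(A,\mu_\alpha,\alpha)$ is a multiplicative non-Hom-associative algebra. Moreover, let $(\tilde A,\tilde\mu)$ be another nonassociative algebra over $\mathbb{K}$, let $\tilde\alpha$ be an automorphism of $(\tilde A,\tilde\mu)$, and put $\tilde\mu_{\tilde\alpha}:=\tilde\alpha\circ\tilde\mu$. If $f:A\to\tilde A$ is an algebra morphism (from $(A,\mu)$ to $(\tilde A,\tilde\mu)$) that satisfies $f\circ\alpha=\tilde\alpha\circ f$, then $f:(A,\mu_\alpha,\alpha)\to(\tilde A,\tilde\mu_{\tilde\alpha},\tilde\alpha)$ is a morphism of multiplicative non-Hom-associative algebras.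
   Context: $\mathbb{K}$ is a field of characteristic $0$; all vector spaces and algebras are over $\mathbb{K}$. A nonassociative (i.e. not necessarily associative) algebra $(A,\mu)$ is a vector space $A$ with a bilinear operation $\mu:A\times A\to A$. A multiplicative non-Hom-associative (i.e. not necessarily Hom-associative) algebra is a triple $(A,\mu,\alpha)$ where $A$ is a vector space, $\alpha:A\to A$ is linear, $\mu:A\times A\to A$ is bilinear, and $\alpha$ is an endomorphism of $(A,\mu)$, i.e. $\alpha(\mu(x,y))=\mu(\alpha(x),\alpha(y))$ for all $x,y\in A$ (multiplicativity). (Hom-associativity, which is not required, is the identity $\mu(\mu(x,y),\alpha(z))=\mu(\alpha(x),\mu(y,z))$.) A morphism $f:(A,\mu,\alpha)\to(\tilde A,\tilde\mu,\tilde\alpha)$ of such algebras is a linear map with $f(\mu(x,y))=\tilde\mu(f(x),f(y))$ for all $x,y\in A$. *)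

theory Defs
  imports Complex_Main
begin

text \<open>
  A vector space over a field \<open>'k\<close> of characteristic 0 is a type \<open>'a\<close> of class
  \<open>ab_group_add\<close> together with a scalar multiplication satisfying the library locale
  \<^locale>\<open>vector_space\<close>. Bilinear operations are curried. Note that the unqualified
  \<open>linear\<close> refers to real vector spaces; \<open>Vector_Spaces.linear\<close> is the general notion.
\<close>

locale nonassoc_algebra = vector_space scale
  for scale :: "'k::field_char_0 \<Rightarrow> 'a::ab_group_add \<Rightarrow> 'a" +
  fixes \<mu> :: "'a \<Rightarrow> 'a \<Rightarrow> 'a"
  assumes linear_right: "\<And>x. Vector_Spaces.linear scale scale (\<lambda>y. \<mu> x y)"
    and linear_left: "\<And>y. Vector_Spaces.linear scale scale (\<lambda>x. \<mu> x y)"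

locale nonassoc_algebra_morphism =
  source: nonassoc_algebra scale \<mu> + target: nonassoc_algebra scale' \<mu>' +
  Vector_Spaces.linear scale scale' f
  for scale :: "'k::field_char_0 \<Rightarrow> 'a::ab_group_add \<Rightarrow> 'a" and \<mu> :: "'a \<Rightarrow> 'a \<Rightarrow> 'a"
    and scale' :: "'k \<Rightarrow> 'b::ab_group_add \<Rightarrow> 'b" and \<mu>' :: "'b \<Rightarrow> 'b \<Rightarrow> 'b"
    and f :: "'a \<Rightarrow> 'b" +
  assumes map_mult: "\<And>x y. f (\<mu> x y) = \<mu>' (f x) (f y)"

locale nonassoc_algebra_automorphism =
  nonassoc_algebra_morphism scale \<mu> scale \<mu> \<alpha>
  for scale :: "'k::field_char_0 \<Rightarrow> 'a::ab_group_add \<Rightarrow> 'a" and \<mu> :: "'a \<Rightarrow> 'a \<Rightarrow> 'a"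
    and \<alpha> :: "'a \<Rightarrow> 'a" +
  assumes bijective: "bij \<alpha>"

text \<open>Hom-associativity is not required: ``non'' means ``not necessarily''.\<close>

locale mult_non_hom_assoc_algebra = nonassoc_algebra scale \<mu> +
  Vector_Spaces.linear scale scale \<alpha>
  for scale :: "'k::field_char_0 \<Rightarrow> 'a::ab_group_add \<Rightarrow> 'a" and \<mu> :: "'a \<Rightarrow> 'a \<Rightarrow> 'a"
    and \<alpha> :: "'a \<Rightarrow> 'a" +
  assumes multiplicative: "\<And>x y. \<alpha> (\<mu> x y) = \<mu> (\<alpha> x) (\<alpha> y)"

text \<open>
  A morphism is only required to be linear and to preserve the products; compatibility with the
  twisting maps \<open>\<alpha>\<close> and \<open>\<alpha>'\<close> is not part of the notion.
\<close>

locale mult_non_hom_assoc_algebra_morphism =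
  source: mult_non_hom_assoc_algebra scale \<mu> \<alpha> +
  target: mult_non_hom_assoc_algebra scale' \<mu>' \<alpha>' +
  Vector_Spaces.linear scale scale' f
  for scale :: "'k::field_char_0 \<Rightarrow> 'a::ab_group_add \<Rightarrow> 'a" and \<mu> :: "'a \<Rightarrow> 'a \<Rightarrow> 'a"
    and \<alpha> :: "'a \<Rightarrow> 'a"
    and scale' :: "'k \<Rightarrow> 'b::ab_group_add \<Rightarrow> 'b" and \<mu>' :: "'b \<Rightarrow> 'b \<Rightarrow> 'b"
    and \<alpha>' :: "'b \<Rightarrow> 'b"
    and f :: "'a \<Rightarrow> 'b" +
  assumes map_mult: "\<And>x y. f (\<mu> x y) = \<mu>' (f x) (f y)"

definition twisted_mult :: "('a \<Rightarrow> 'a) \<Rightarrow> ('a \<Rightarrow> 'a \<Rightarrow> 'a) \<Rightarrow> 'a \<Rightarrow> 'a \<Rightarrow> 'a"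
  where "twisted_mult \<alpha> \<mu> = (\<lambda>x y. \<alpha> (\<mu> x y))"

end

theory Submission
  imports Defs
begin

text \<open>Twisting composes the product with a linear map that respects it, so each required
  identity is an old one with a twist applied to it. Applying \<alpha> to \<alpha>(\<mu> x y) =
  \<mu> (\<alpha> x) (\<alpha> y) gives multiplicativity of \<alpha> for the twisted product
  (\<open>mult_non_hom_assoc_algebra_twisted_mult\<close>). For morphisms, f first moves past
  \<alpha> by the intertwining relation and then past \<mu>: f(\<alpha>(\<mu> x y)) =
  \<alpha>'(f(\<mu> x y)) = \<alpha>'(\<mu>' (f x) (f y))
  (\<open>mult_non_hom_assoc_algebra_morphism_twisted_mult\<close>).\<close>

lemma nonassoc_algebra_twisted_mult:
  assumes "nonassoc_algebra scale \<mu>" and "Vector_Spaces.linear scale scale \<alpha>"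
  shows "nonassoc_algebra scale (twisted_mult \<alpha> \<mu>)"
proof -
  interpret nonassoc_algebra scale \<mu> by fact
  show ?thesis
    \<comment> \<open>With one argument fixed, the twisted product is a linear map followed by
      \<alpha>, and composites of linear maps are linear.\<close>
    using Vector_Spaces.linear_compose[OF linear_right assms(2)]
      Vector_Spaces.linear_compose[OF linear_left assms(2)]
    by (intro nonassoc_algebra.intro nonassoc_algebra_axioms.intro vector_space_axioms)
      (simp_all add: twisted_mult_def o_def)
qed

lemma mult_non_hom_assoc_algebra_twisted_mult:
  assumes "nonassoc_algebra_automorphism scale \<mu> \<alpha>"
  shows "mult_non_hom_assoc_algebra scale (twisted_mult \<alpha> \<mu>) \<alpha>"
proof -
  interpret nonassoc_algebra_automorphism scale \<mu> \<alpha> by fact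
  interpret twisted: nonassoc_algebra scale "twisted_mult \<alpha> \<mu>"
    by (intro nonassoc_algebra_twisted_mult source.nonassoc_algebra_axioms linear_axioms)
  show ?thesis
    \<comment> \<open>Pushing \<alpha> inward through \<mu> brings both sides to \<mu> (\<alpha>
      (\<alpha> x)) (\<alpha> (\<alpha> y)).\<close>
    by unfold_locales (simp add: twisted_mult_def map_mult)
qed

text \<open>The previous lemma supplies both the source and the target structure, and f is already
  linear; what remains is compatibility with the twisted products.\<close>

lemma mult_non_hom_assoc_algebra_morphism_twisted_mult:
  assumes "nonassoc_algebra_automorphism scale \<mu> \<alpha>"
    and "nonassoc_algebra_automorphism scale' \<mu>' \<alpha>'"
    and "nonassoc_algebra_morphism scale \<mu> scale' \<mu>' f"
    and "f \<circ> \<alpha> = \<alpha>' \<circ> f"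
  shows "mult_non_hom_assoc_algebra_morphism
    scale (twisted_mult \<alpha> \<mu>) \<alpha> scale' (twisted_mult \<alpha>' \<mu>') \<alpha>' f"
proof -
  interpret f: nonassoc_algebra_morphism scale \<mu> scale' \<mu>' f by fact
  have "f (twisted_mult \<alpha> \<mu> x y) = twisted_mult \<alpha>' \<mu>' (f x) (f y)" for x y
    \<comment> \<open>The intertwining relation is needed at the untwisted product \<mu> x y, since
      that is the element to which \<alpha> is applied.\<close>
    using fun_cong[OF assms(4), of "\<mu> x y"] by (simp add: twisted_mult_def f.map_mult)
  then show ?thesis
    by (intro mult_non_hom_assoc_algebra_morphism.intro
        mult_non_hom_assoc_algebra_morphism_axioms.intro
        mult_non_hom_assoc_algebra_twisted_mult assms f.linear_axioms)
qed

theorem theorem3p6: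
  fixes scale :: "'k::field_char_0 \<Rightarrow> 'a::ab_group_add \<Rightarrow> 'a"
    and \<mu> :: "'a \<Rightarrow> 'a \<Rightarrow> 'a" and \<alpha> :: "'a \<Rightarrow> 'a"
  assumes "nonassoc_algebra scale \<mu>"
    and "nonassoc_algebra_automorphism scale \<mu> \<alpha>"
  shows "mult_non_hom_assoc_algebra scale (twisted_mult \<alpha> \<mu>) \<alpha> \<and>
    (\<forall>(scale' :: 'k \<Rightarrow> 'b::ab_group_add \<Rightarrow> 'b) \<mu>' \<alpha>' f.
      nonassoc_algebra scale' \<mu>' \<longrightarrow>
      nonassoc_algebra_automorphism scale' \<mu>' \<alpha>' \<longrightarrow>
      nonassoc_algebra_morphism scale \<mu> scale' \<mu>' f \<longrightarrow>
      f \<circ> \<alpha> = \<alpha>' \<circ> f \<longrightarrow>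
      mult_non_hom_assoc_algebra_morphism
        scale (twisted_mult \<alpha> \<mu>) \<alpha> scale' (twisted_mult \<alpha>' \<mu>') \<alpha>' f)"
  using assms(2)
  by (simp add: mult_non_hom_assoc_algebra_twisted_mult
      mult_non_hom_assoc_algebra_morphism_twisted_mult)

end
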